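(* Let $\mathbb{K}$ be $\mathbb{C}$ or $\mathbb{R}$ and let $\mathfrak{h}_2$ be the $5$-dimensional Heisenberg Lie algebra over $\mathbb{K}$ with basis $\{e_1,\dots,e_5\}$ and nonzero brackets $[e_1,e_3]=e_5$, $[e_2,e_4]=e_5$ (up to skew-symmetry). For $p,q,r\in\mathbb{K}$ let $\phi_7(p:q:r):\mathfrak{h}_2\times\mathfrak{h}_2\to\mathfrak{h}_2$ be the skew-symmetric bilinear map with $$\phi_7(e_1,e_3)=pe_1,\quad \phi_7(e_2,e_3)=e_1+qe_2,\quad \phi_7(e_3,e_4)=-e_2-re_4,\quad \phi_7(e_3,e_5)=-(q+r)e_5,$$ and all other values on pairs $(e_i,e_j)$ with $i<j$ equal to zero. Then for all $p,q,r\in\mathbb{K}$ the map $\phi_7(p:q:r)$ is a $2$-cocycle of $\mathfrak{h}_2$ with adjoint coefficients, and $\mu_t(d_7)(p:q:r)=[-,-]+t\,\phi_7(p:q:r)$, i.e. the bracket with nonzero values (up to skew-symmetry) $$[e_1,e_3]_t=e_5+tpe_1,\quad [e_2,e_3]_t=te_1+qte_2,\quad [e_2,e_4]_t=e_5,\quad [e_3,e_4]_t=-te_2-tre_4,\quad [e_3,e_5]_t=-(r+q)te_5,$$ is an infinitesimal deformation of $\mathfrak{h}_2$. Moreover, the linear span in $H^2(\mathfrak{h}_2,\mathfrak{h}_2)$ of the cohomology classes of the cocycles $\phi_7(p:q:r)$, $p,q,r\in\mathbb{K}$, is $4$-dimensional.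
   Context: For a Lie algebra $(\mathfrak{g},[-,-])$ over $\mathbb{K}$, $C^q(\mathfrak{g},\mathfrak{g})=\mathrm{Hom}_{\mathbb{K}}(\Lambda^q\mathfrak{g},\mathfrak{g})$ is the Chevalley--Eilenberg cochain space with adjoint coefficients, with differential $d$, and $H^q(\mathfrak{g},\mathfrak{g})$ denotes its cohomology. A $2$-cochain $\phi$ is a $2$-cocycle iff the cyclic sum over $(x,y,z)$ of $[x,\phi(y,z)]+\phi(x,[y,z])$ vanishes for all $x,y,z\in\mathfrak{g}$; the $2$-coboundaries are the maps $(x,y)\mapsto f([x,y])-[f(x),y]-[x,f(y)]$ with $f:\mathfrak{g}\to\mathfrak{g}$ linear. Given a $2$-cochain $\phi$, extend the bracket $[-,-]_t=[-,-]+t\phi$ to $\mathfrak{g}[[t]]$ by $\mathbb{K}[[t]]$-bilinearity. It is called an infinitesimal deformation of $\mathfrak{g}$ if it satisfies the Jacobi identity modulo $t^2$ (equivalently, $\phi$ is a $2$-cocycle). *)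

theory Defs
  imports "HOL-Analysis.Analysis" "HOL-Computational_Algebra.Formal_Power_Series"
begin

section \<open>Adjoint Chevalley--Eilenberg cohomology in degree two\<close>

text \<open>Lie algebras with underlying space \<open>\<bbbK>\<^sup>n\<close> are given by their bracket;
  scalar multiplication is \<open>(*s)\<close>.\<close>

definition bilinear_map :: "(('k::field)^'n \<Rightarrow> 'k^'n \<Rightarrow> 'k^'n) \<Rightarrow> bool" where
  "bilinear_map \<phi> \<longleftrightarrow>
     (\<forall>x. Vector_Spaces.linear (*s) (*s) (\<phi> x)) \<and>
     (\<forall>y. Vector_Spaces.linear (*s) (*s) (\<lambda>x. \<phi> x y))"

text \<open>\<open>Hom(\<Lambda>\<^sup>2 \<gg>, \<gg>)\<close>, as alternating bilinear maps.\<close>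

definition cochain2 :: "(('k::field)^'n \<Rightarrow> 'k^'n \<Rightarrow> 'k^'n) \<Rightarrow> bool" where
  "cochain2 \<phi> \<longleftrightarrow> bilinear_map \<phi> \<and> (\<forall>x. \<phi> x x = 0)"

definition jacobiator :: "('a \<Rightarrow> 'a \<Rightarrow> 'a) \<Rightarrow> 'a \<Rightarrow> 'a \<Rightarrow> 'a \<Rightarrow> ('a::ab_group_add)" where
  "jacobiator \<mu> x y z = \<mu> x (\<mu> y z) + \<mu> y (\<mu> z x) + \<mu> z (\<mu> x y)"

definition lie_bracket :: "(('k::field)^'n \<Rightarrow> 'k^'n \<Rightarrow> 'k^'n) \<Rightarrow> bool" where
  "lie_bracket \<mu> \<longleftrightarrow> cochain2 \<mu> \<and> (\<forall>x y z. jacobiator \<mu> x y z = 0)"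

definition cocycle2 ::
    "(('k::field)^'n \<Rightarrow> 'k^'n \<Rightarrow> 'k^'n) \<Rightarrow> ('k^'n \<Rightarrow> 'k^'n \<Rightarrow> 'k^'n) \<Rightarrow> bool" where
  "cocycle2 \<mu> \<phi> \<longleftrightarrow> cochain2 \<phi> \<and>
     (\<forall>x y z. (\<mu> x (\<phi> y z) + \<phi> x (\<mu> y z))
            + (\<mu> y (\<phi> z x) + \<phi> y (\<mu> z x))
            + (\<mu> z (\<phi> x y) + \<phi> z (\<mu> x y)) = 0)"

definition coboundary2 ::
    "(('k::field)^'n \<Rightarrow> 'k^'n \<Rightarrow> 'k^'n) \<Rightarrow> ('k^'n \<Rightarrow> 'k^'n \<Rightarrow> 'k^'n) \<Rightarrow> bool" where
  "coboundary2 \<mu> \<phi> \<longleftrightarrow>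
     (\<exists>f. Vector_Spaces.linear (*s) (*s) f \<and>
          (\<forall>x y. \<phi> x y = f (\<mu> x y) - \<mu> (f x) y - \<mu> x (f y)))"

definition cohomologous2 ::
    "(('k::field)^'n \<Rightarrow> 'k^'n \<Rightarrow> 'k^'n) \<Rightarrow> ('k^'n \<Rightarrow> 'k^'n \<Rightarrow> 'k^'n) \<Rightarrow>
     ('k^'n \<Rightarrow> 'k^'n \<Rightarrow> 'k^'n) \<Rightarrow> bool" where
  "cohomologous2 \<mu> \<phi> \<psi> \<longleftrightarrow> cocycle2 \<mu> \<phi> \<and> cocycle2 \<mu> \<psi> \<and>
     coboundary2 \<mu> (\<lambda>x y. \<phi> x y - \<psi> x y)"


section \<open>Infinitesimal deformations\<close>

text \<open>For \<open>\<gg> = \<bbbK>\<^sup>n\<close>, the \<open>\<bbbK>[[t]]\<close>-module \<open>\<gg>[[t]]\<close> is \<open>\<bbbK>[[t]]\<^sup>n\<close>, that is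
  \<open>'k fps ^ 'n\<close>, with \<open>t\<close> being \<^term>\<open>fps_X\<close>.\<close>

definition const_vec :: "('k::zero)^'n \<Rightarrow> 'k fps ^ 'n" where
  "const_vec v = (\<chi> i. fps_const (v $ i))"

text \<open>The \<open>\<bbbK>[[t]]\<close>-bilinear extension of \<open>\<mu> + t \<phi>\<close> to \<open>\<gg>[[t]]\<close>. As \<open>\<gg>[[t]]\<close> is free on the
  standard basis \<open>axis i 1\<close> of \<open>\<gg>\<close>, it is determined by its values on that basis.\<close>

definition deformed_bracket ::
    "(('k::field)^'n \<Rightarrow> 'k^'n \<Rightarrow> 'k^'n) \<Rightarrow> ('k^'n \<Rightarrow> 'k^'n \<Rightarrow> 'k^'n) \<Rightarrow>
     'k fps ^ 'n \<Rightarrow> 'k fps ^ 'n \<Rightarrow> 'k fps ^ 'n" where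
  "deformed_bracket \<mu> \<phi> u v =
     (\<Sum>i\<in>UNIV. \<Sum>j\<in>UNIV. (u $ i * v $ j) *s
        (const_vec (\<mu> (axis i 1) (axis j 1)) + fps_X *s const_vec (\<phi> (axis i 1) (axis j 1))))"

definition infinitesimal_deformation ::
    "(('k::field)^'n \<Rightarrow> 'k^'n \<Rightarrow> 'k^'n) \<Rightarrow> ('k^'n \<Rightarrow> 'k^'n \<Rightarrow> 'k^'n) \<Rightarrow> bool" where
  "infinitesimal_deformation \<mu> \<phi> \<longleftrightarrow> lie_bracket \<mu> \<and> cochain2 \<phi> \<and>
     (\<forall>u v w. \<exists>r. jacobiator (deformed_bracket \<mu> \<phi>) u v w = fps_X ^ 2 *s r)"


section \<open>The Heisenberg algebra and the cochains \<open>\<phi>\<^sub>7\<close>\<close>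

text \<open>Basis vectors are indexed by the numeral type \<open>5\<close>, whose elements are \<open>1, 2, 3, 4, 5\<close>
  (arithmetic is modulo 5, so \<open>5 = 0\<close>; the order on this type is never used). The same
  \<open>e i\<close> serves as basis of \<open>\<bbbK>\<^sup>5\<close> and of \<open>\<bbbK>[[t]]\<^sup>5\<close>.\<close>

abbreviation e :: "5 \<Rightarrow> ('k::{zero,one})^5" where
  "e i \<equiv> axis i 1"

definition wedge :: "5 \<Rightarrow> 5 \<Rightarrow> ('k::field)^5 \<Rightarrow> 'k^5 \<Rightarrow> 'k" where
  "wedge i j x y = x $ i * y $ j - x $ j * y $ i"

definition h2_bracket :: "('k::field)^5 \<Rightarrow> 'k^5 \<Rightarrow> 'k^5" where
  "h2_bracket x y = wedge 1 3 x y *s e 5 + wedge 2 4 x y *s e 5"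

definition phi7 :: "('k::field) \<Rightarrow> 'k \<Rightarrow> 'k \<Rightarrow> 'k^5 \<Rightarrow> 'k^5 \<Rightarrow> 'k^5" where
  "phi7 p q r x y =
     wedge 1 3 x y *s (p *s e 1) +
     wedge 2 3 x y *s (e 1 + q *s e 2) +
     wedge 3 4 x y *s (- e 2 - r *s e 4) +
     wedge 3 5 x y *s (- ((q + r) *s e 5))"

definition mu_t_d7 :: "('k::field) \<Rightarrow> 'k \<Rightarrow> 'k \<Rightarrow> 'k fps ^ 5 \<Rightarrow> 'k fps ^ 5 \<Rightarrow> 'k fps ^ 5" where
  "mu_t_d7 p q r = deformed_bracket h2_bracket (phi7 p q r)"

lemma UNIV_5: "(UNIV :: 5 set) = {1, 2, 3, 4, 5}"
proof -
  have "card {1, 2, 3, 4, 5 :: 5} = card (UNIV :: 5 set)"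
    by simp
  then show ?thesis
    by (metis card_subset_eq finite subset_UNIV)
qed

lemma forall_5: "(\<forall>i::5. P i) \<longleftrightarrow> P 1 \<and> P 2 \<and> P 3 \<and> P 4 \<and> P 5"
  by (metis UNIV_5 UNIV_I empty_iff insert_iff)

lemma lie_bracket_h2: "lie_bracket (h2_bracket :: ('k::field)^5 \<Rightarrow> _)"
  unfolding lie_bracket_def cochain2_def bilinear_map_def jacobiator_def
  by (auto intro!: Vector_Spaces.linear_iff[THEN iffD2] vec.vector_space_axioms
      simp: h2_bracket_def wedge_def vec_eq_iff forall_5 axis_def algebra_simps)

lemma h2_bracket_basis:
  "h2_bracket (e 1) (e 3) = e 5"
  "h2_bracket (e 2) (e 4) = e 5"
  "(i, j) \<in> {(1,2), (1,4), (1,5), (2,3), (2,5), (3,4), (3,5), (4,5)} \<Longrightarrow>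
     h2_bracket (e i) (e j) = 0"
  by (auto simp: h2_bracket_def wedge_def axis_def)

lemma phi7_basis:
  "phi7 p q r (e 1) (e 3) = p *s e 1"
  "phi7 p q r (e 2) (e 3) = e 1 + q *s e 2"
  "phi7 p q r (e 3) (e 4) = - e 2 - r *s e 4"
  "phi7 p q r (e 3) (e 5) = - ((q + r) *s e 5)"
  "(i, j) \<in> {(1,2), (1,4), (1,5), (2,4), (2,5), (4,5)} \<Longrightarrow> phi7 p q r (e i) (e j) = 0"
  by (auto simp: phi7_def wedge_def axis_def)


section \<open>The vector space \<open>H\<^sup>2(\<hh>\<^sub>2, \<hh>\<^sub>2)\<close>\<close>

lemma lin_iff:
  "Vector_Spaces.linear (*s) (*s) (f :: ('k::field)^'n \<Rightarrow> 'k^'m) \<longleftrightarrow>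
     (\<forall>x y. f (x + y) = f x + f y) \<and> (\<forall>c x. f (c *s x) = c *s f x)"
  by (simp add: Vector_Spaces.linear_iff vec.vector_space_axioms)

lemma cocycle2_combine:
  assumes "lie_bracket \<mu>" "cocycle2 \<mu> \<phi>" "cocycle2 \<mu> \<psi>"
  shows "cocycle2 \<mu> (\<lambda>x y. a *s \<phi> x y + b *s \<psi> x y)"
proof -
  have lin: "\<And>x u v. \<mu> x (u + v) = \<mu> x u + \<mu> x v" "\<And>x c u. \<mu> x (c *s u) = c *s \<mu> x u"
    using assms(1) by (auto simp: lie_bracket_def cochain2_def bilinear_map_def lin_iff)
  have \<phi>: "cochain2 \<phi>" and \<psi>: "cochain2 \<psi>"
    using assms by (auto simp: cocycle2_def)
  have "cochain2 (\<lambda>x y. a *s \<phi> x y + b *s \<psi> x y)"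
    using \<phi> \<psi> unfolding cochain2_def bilinear_map_def lin_iff
    by (auto simp: vec_eq_iff algebra_simps)
  moreover have "(\<mu> x (a *s \<phi> y z + b *s \<psi> y z) + (a *s \<phi> x (\<mu> y z) + b *s \<psi> x (\<mu> y z)))
       + (\<mu> y (a *s \<phi> z x + b *s \<psi> z x) + (a *s \<phi> y (\<mu> z x) + b *s \<psi> y (\<mu> z x)))
       + (\<mu> z (a *s \<phi> x y + b *s \<psi> x y) + (a *s \<phi> z (\<mu> x y) + b *s \<psi> z (\<mu> x y))) = 0"
    (is "?l = 0") for x y z
  proof -
    have "?l = a *s ((\<mu> x (\<phi> y z) + \<phi> x (\<mu> y z)) + (\<mu> y (\<phi> z x) + \<phi> y (\<mu> z x))
            + (\<mu> z (\<phi> x y) + \<phi> z (\<mu> x y)))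
        + b *s ((\<mu> x (\<psi> y z) + \<psi> x (\<mu> y z)) + (\<mu> y (\<psi> z x) + \<psi> y (\<mu> z x))
            + (\<mu> z (\<psi> x y) + \<psi> z (\<mu> x y)))"
      by (simp add: lin vec_eq_iff algebra_simps)
    also have "\<dots> = a *s 0 + b *s 0"
      using assms(2,3) unfolding cocycle2_def by presburger
    finally show ?thesis by simp
  qed
  ultimately show ?thesis
    by (simp add: cocycle2_def)
qed

lemma coboundary2_combine:
  assumes "lie_bracket \<mu>" "coboundary2 \<mu> \<phi>" "coboundary2 \<mu> \<psi>"
  shows "coboundary2 \<mu> (\<lambda>x y. a *s \<phi> x y + b *s \<psi> x y)"
proof -
  have lin: "\<And>x u v. \<mu> x (u + v) = \<mu> x u + \<mu> x v" "\<And>x c u. \<mu> x (c *s u) = c *s \<mu> x u"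
    "\<And>x u v. \<mu> (u + v) x = \<mu> u x + \<mu> v x" "\<And>x c u. \<mu> (c *s u) x = c *s \<mu> u x"
    using assms(1) by (auto simp: lie_bracket_def cochain2_def bilinear_map_def lin_iff)
  obtain f where f: "Vector_Spaces.linear (*s) (*s) f"
    "\<And>x y. \<phi> x y = f (\<mu> x y) - \<mu> (f x) y - \<mu> x (f y)"
    using assms(2) by (auto simp: coboundary2_def)
  obtain g where g: "Vector_Spaces.linear (*s) (*s) g"
    "\<And>x y. \<psi> x y = g (\<mu> x y) - \<mu> (g x) y - \<mu> x (g y)"
    using assms(3) by (auto simp: coboundary2_def)
  have "Vector_Spaces.linear (*s) (*s) (\<lambda>x. a *s f x + b *s g x)"
    using f(1) g(1) unfolding lin_iff by (auto simp: vec_eq_iff algebra_simps)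
  then show ?thesis
    unfolding coboundary2_def
    by (intro exI[of _ "\<lambda>x. a *s f x + b *s g x"])
       (auto simp: f(2) g(2) lin vec_eq_iff algebra_simps)
qed

lemma lie_bracket_zero:
  assumes "lie_bracket \<mu>"
  shows "\<mu> x 0 = 0" "\<mu> 0 x = 0"
proof -
  have "\<mu> x (0 *s x) = 0 *s \<mu> x x" "\<mu> (0 *s x) x = 0 *s \<mu> x x"
    using assms unfolding lie_bracket_def cochain2_def bilinear_map_def lin_iff by blast+
  then show "\<mu> x 0 = 0" "\<mu> 0 x = 0"
    by simp_all
qed

lemma cocycle2_zero: "lie_bracket \<mu> \<Longrightarrow> cocycle2 \<mu> (\<lambda>x y. 0)"
  by (simp add: cocycle2_def cochain2_def bilinear_map_def lin_iff lie_bracket_zero)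

lemma coboundary2_zero: "lie_bracket \<mu> \<Longrightarrow> coboundary2 \<mu> (\<lambda>x y. 0)"
  unfolding coboundary2_def
  by (rule exI[of _ "\<lambda>x. 0"]) (simp add: lin_iff lie_bracket_zero)

lemma cohomologous2_combine:
  assumes "lie_bracket \<mu>" "cohomologous2 \<mu> \<phi> \<phi>'" "cohomologous2 \<mu> \<psi> \<psi>'"
  shows "cohomologous2 \<mu> (\<lambda>x y. a *s \<phi> x y + b *s \<psi> x y) (\<lambda>x y. a *s \<phi>' x y + b *s \<psi>' x y)"
proof -
  have "(\<lambda>x y. (a *s \<phi> x y + b *s \<psi> x y) - (a *s \<phi>' x y + b *s \<psi>' x y)) =
        (\<lambda>x y. a *s (\<phi> x y - \<phi>' x y) + b *s (\<psi> x y - \<psi>' x y))"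
    by (simp add: fun_eq_iff vec_eq_iff algebra_simps)
  moreover have "coboundary2 \<mu> (\<lambda>x y. a *s (\<phi> x y - \<phi>' x y) + b *s (\<psi> x y - \<psi>' x y))"
    using assms by (intro coboundary2_combine) (simp_all add: cohomologous2_def)
  ultimately show ?thesis
    using assms by (simp add: cohomologous2_def cocycle2_combine)
qed

lemma part_equivp_cohomologous2:
  assumes "lie_bracket \<mu>"
  shows "part_equivp (cohomologous2 \<mu>)"
proof (rule part_equivpI)
  show "\<exists>\<phi>. cohomologous2 \<mu> \<phi> \<phi>"
    by (rule exI[of _ "\<lambda>x y. 0"])
       (simp add: cohomologous2_def cocycle2_zero coboundary2_zero assms)
  show "symp (cohomologous2 \<mu>)"
  proof (rule sympI)
    fix \<phi> \<psi> assume *: "cohomologous2 \<mu> \<phi> \<psi>"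
    then show "cohomologous2 \<mu> \<psi> \<phi>"
      using coboundary2_combine[OF assms, of "\<lambda>x y. \<phi> x y - \<psi> x y" "\<lambda>x y. \<phi> x y - \<psi> x y" "-1" 0]
      by (simp add: cohomologous2_def)
  qed
  show "transp (cohomologous2 \<mu>)"
  proof (rule transpI)
    fix \<phi> \<psi> \<theta> assume *: "cohomologous2 \<mu> \<phi> \<psi>" "cohomologous2 \<mu> \<psi> \<theta>"
    then show "cohomologous2 \<mu> \<phi> \<theta>"
      using coboundary2_combine[OF assms, of "\<lambda>x y. \<phi> x y - \<psi> x y" "\<lambda>x y. \<psi> x y - \<theta> x y" 1 1]
      by (simp add: cohomologous2_def)
  qed
qed

text \<open>\<open>H\<^sup>2 = Z\<^sup>2 / B\<^sup>2\<close>. The relation is reflexive exactly on the cocycles, so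
  \<open>abs_h2_cohomology\<close> is meaningful only on cocycles, where it sends a cocycle to its class.\<close>

quotient_type (overloaded) 'k h2_cohomology =
  "('k::field)^5 \<Rightarrow> 'k^5 \<Rightarrow> 'k^5" / partial: "cohomologous2 h2_bracket"
  by (rule part_equivp_cohomologous2[OF lie_bracket_h2])

lemma cohomologous2_h2_refl:
  "cohomologous2 h2_bracket \<phi> \<phi> \<longleftrightarrow> cocycle2 h2_bracket \<phi>"
  by (simp add: cohomologous2_def coboundary2_zero lie_bracket_h2)

lemma cocycle2_h2_closed:
  assumes "cocycle2 h2_bracket \<phi>"
  shows "cocycle2 h2_bracket \<psi> \<Longrightarrow> cocycle2 h2_bracket (\<lambda>x y. \<phi> x y + \<psi> x y)"
    and "cocycle2 h2_bracket \<psi> \<Longrightarrow> cocycle2 h2_bracket (\<lambda>x y. \<phi> x y - \<psi> x y)"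
    and "cocycle2 h2_bracket (\<lambda>x y. c *s \<phi> x y)"
  using cocycle2_combine[OF lie_bracket_h2 assms, of \<psi> 1 1]
    cocycle2_combine[OF lie_bracket_h2 assms, of \<psi> 1 "-1"]
    cocycle2_combine[OF lie_bracket_h2 assms assms, of c 0]
  by simp_all

instantiation h2_cohomology :: (field) ab_group_add
begin

lift_definition zero_h2_cohomology :: "'a h2_cohomology" is "\<lambda>x y. 0"
  by (simp add: cohomologous2_def cocycle2_zero coboundary2_zero lie_bracket_h2)

lift_definition plus_h2_cohomology ::
    "'a h2_cohomology \<Rightarrow> 'a h2_cohomology \<Rightarrow> 'a h2_cohomology"
  is "\<lambda>\<phi> \<psi> x y. \<phi> x y + \<psi> x y"
  using cohomologous2_combine[OF lie_bracket_h2, where a = 1 and b = 1] by simp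

lift_definition minus_h2_cohomology ::
    "'a h2_cohomology \<Rightarrow> 'a h2_cohomology \<Rightarrow> 'a h2_cohomology"
  is "\<lambda>\<phi> \<psi> x y. \<phi> x y - \<psi> x y"
  using cohomologous2_combine[OF lie_bracket_h2, where a = 1 and b = "-1"] by simp

lift_definition uminus_h2_cohomology :: "'a h2_cohomology \<Rightarrow> 'a h2_cohomology"
  is "\<lambda>\<phi> x y. - \<phi> x y"
  subgoal for \<phi> \<psi>
    using cohomologous2_combine[OF lie_bracket_h2, where a = "-1" and b = 0, of \<phi> \<psi> \<phi> \<psi>] by simp
  done

instance
proof
  fix a b c :: "'a h2_cohomology"
  show "a + b + c = a + (b + c)" "a + b = b + a" "0 + a = a" "- a + a = 0" "a - b = a + - b"
    by (transfer, simp add: cohomologous2_h2_refl cocycle2_h2_closed cocycle2_zero lie_bracket_h2 add_ac)+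
qed

end

lift_definition h2_cohomology_scale :: "'k::field \<Rightarrow> 'k h2_cohomology \<Rightarrow> 'k h2_cohomology"
  is "\<lambda>c \<phi> x y. c *s \<phi> x y"
  subgoal for c \<phi> \<psi>
    using cohomologous2_combine[OF lie_bracket_h2, where a = c and b = 0, of \<phi> \<psi> \<phi> \<psi>] by simp
  done

interpretation HH2: vector_space h2_cohomology_scale
proof
  fix a b :: "'k::field" and u v :: "'k h2_cohomology"
  show "h2_cohomology_scale a (u + v) = h2_cohomology_scale a u + h2_cohomology_scale a v"
    "h2_cohomology_scale (a + b) u = h2_cohomology_scale a u + h2_cohomology_scale b u"
    "h2_cohomology_scale a (h2_cohomology_scale b u) = h2_cohomology_scale (a * b) u"
    "h2_cohomology_scale 1 u = u"
    by (transfer, simp add: cohomologous2_h2_refl cocycle2_h2_closed vec.scale_right_distrib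
        vec.scale_left_distrib)+
qed

end

theory Submission
  imports Defs
begin

text \<open>Over K[[t]] the Jacobiator of \<open>deformed_bracket\<close> is trilinear, so the
  Jacobi identity modulo t^2 need only be tested on the standard basis
  (\<open>linear_image_principal\<close> with c = t^2). On constant vectors that Jacobiator expands
  in powers of t: the constant term is the Jacobiator of the undeformed bracket, the t term is the
  cocycle expression. Hence every cocycle gives an infinitesimal deformation
  (\<open>infinitesimal_deformation_if_cocycle2\<close>), and for \<open>phi7\<close> the cocycle
  condition is a coordinate check.

  For the dimension, \<open>phi7 p q r\<close> is affine in (p, q, r), so four classes span.
  Coboundaries of the Heisenberg algebra are very restricted away from the central direction e5
  (\<open>coboundary2_h2_basis\<close>); comparing a few coefficients shows that the four classes
  are independent (\<open>phi7_class_independent\<close>). The arguments work over any field and are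
  specialised to the reals and the complex numbers at the end.\<close>

section \<open>Deformed brackets over K[[t]]\<close>

lemma linear_image_principal:
  fixes f :: "'a::comm_ring_1 ^ 'n \<Rightarrow> 'a ^ 'm" and c :: 'a
  assumes add: "\<And>u v. f (u + v) = f u + f v" and scale: "\<And>a u. f (a *s u) = a *s f u"
    and basis: "\<And>i. \<exists>r. f (axis i 1) = c *s r"
  shows "\<exists>r. f u = c *s r"
proof -
  obtain r where r: "\<And>i. f (axis i 1) = c *s r i"
    using basis by metis
  have zero: "f 0 = 0"
    using scale[of 0 0] by simp
  have sum: "f (\<Sum>i\<in>A. g i) = (\<Sum>i\<in>A. f (g i))" for g and A :: "'n set"
    by (induction A rule: infinite_finite_induct) (simp_all add: zero add)
  have "f u = f (\<Sum>i\<in>UNIV. u $ i *s axis i 1)"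
    by (simp add: basis_expansion)
  also have "\<dots> = c *s (\<Sum>i\<in>UNIV. u $ i *s r i)"
    by (simp add: sum scale r vec_eq_iff sum_distrib_left mult_ac)
  finally show ?thesis by blast
qed

lemma sum_axis_mult:
  fixes f :: "'n::finite \<Rightarrow> 'a::comm_ring_1"
  shows "(\<Sum>i\<in>UNIV. axis k 1 $ i * f i) = f k"
proof -
  have "(\<Sum>i\<in>UNIV. axis k 1 $ i * f i) = (\<Sum>i\<in>UNIV. if i = k then f i else 0)"
    by (intro sum.cong) (auto simp: axis_def)
  then show ?thesis by simp
qed

lemma deformed_bracket_axis:
  "deformed_bracket \<mu> \<phi> (axis i 1) (axis j 1) =
     const_vec (\<mu> (axis i 1) (axis j 1)) + fps_X *s const_vec (\<phi> (axis i 1) (axis j 1))"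
  by (simp add: vec_eq_iff deformed_bracket_def algebra_simps sum.distrib sum_axis_mult
      flip: sum_distrib_left)

lemma deformed_bracket_add:
  "deformed_bracket \<mu> \<phi> (u + v) w = deformed_bracket \<mu> \<phi> u w + deformed_bracket \<mu> \<phi> v w"
  "deformed_bracket \<mu> \<phi> w (u + v) = deformed_bracket \<mu> \<phi> w u + deformed_bracket \<mu> \<phi> w v"
  by (simp_all add: deformed_bracket_def vec_eq_iff algebra_simps sum.distrib)

lemma deformed_bracket_scale:
  "deformed_bracket \<mu> \<phi> (a *s u) v = a *s deformed_bracket \<mu> \<phi> u v"
  "deformed_bracket \<mu> \<phi> u (a *s v) = a *s deformed_bracket \<mu> \<phi> u v"
  by (simp_all add: deformed_bracket_def vec_eq_iff sum_distrib_left algebra_simps)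

lemma linear_basis_expansion:
  fixes f :: "('k::field)^'n \<Rightarrow> 'k^'m"
  assumes "Vector_Spaces.linear (*s) (*s) f"
  shows "f x = (\<Sum>i\<in>UNIV. x $ i *s f (axis i 1))"
proof -
  interpret f: Vector_Spaces.linear "(*s)" "(*s)" f by fact
  have "f x = f (\<Sum>i\<in>UNIV. x $ i *s axis i 1)"
    by (simp add: basis_expansion)
  then show ?thesis by (simp add: f.sum f.scale)
qed

lemma const_vec_simps:
  fixes x y :: "('k::field)^'n"
  shows "const_vec (x + y) = const_vec x + const_vec y"
  "const_vec (c *s x) = fps_const c *s const_vec x"
  "const_vec (- x) = - const_vec x"
  "const_vec (x - y) = const_vec x - const_vec y"
  "const_vec 0 = 0"
  "const_vec (axis i 1 :: 'k^'n) = axis i 1"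
  by (simp_all add: const_vec_def vec_eq_iff axis_def)

lemma const_vec_sum:
  fixes f :: "'a \<Rightarrow> ('k::field)^'n"
  shows "const_vec (sum f A) = (\<Sum>i\<in>A. const_vec (f i))"
  by (induction A rule: infinite_finite_induct) (simp_all add: const_vec_simps)

lemma bilinear_map_basis_expansion:
  assumes "bilinear_map \<phi>"
  shows "\<phi> x y = (\<Sum>i\<in>UNIV. \<Sum>j\<in>UNIV. (x $ i * y $ j) *s \<phi> (axis i 1) (axis j 1))"
proof -
  have left: "\<phi> x y = (\<Sum>i\<in>UNIV. x $ i *s \<phi> (axis i 1) y)"
    by (rule linear_basis_expansion[of "\<lambda>x. \<phi> x y"]) (use assms in \<open>simp add: bilinear_map_def\<close>)
  have right: "\<phi> u y = (\<Sum>j\<in>UNIV. y $ j *s \<phi> u (axis j 1))" for u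
    by (rule linear_basis_expansion[of "\<phi> u"]) (use assms in \<open>simp add: bilinear_map_def\<close>)
  show ?thesis
    by (subst left, subst right) (simp add: vec.scale_sum_right)
qed

text \<open>The definition prescribes values on basis vectors only. Nested brackets also need them
  at vectors such as \<open>\<mu> y z\<close>, where bilinearity of both maps gives the same
  formula.\<close>

lemma deformed_bracket_const_vec:
  assumes "bilinear_map \<mu>" "bilinear_map \<phi>"
  shows "deformed_bracket \<mu> \<phi> (const_vec x) (const_vec y) =
    const_vec (\<mu> x y) + fps_X *s const_vec (\<phi> x y)"
  unfolding bilinear_map_basis_expansion[OF assms(1), of x y]
    bilinear_map_basis_expansion[OF assms(2), of x y]
  by (simp add: deformed_bracket_def const_vec_sum const_vec_simps vec_eq_iff
      sum.distrib sum_distrib_left algebra_simps)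
     (simp add: const_vec_def mult.assoc)

lemma cochain2_skew:
  assumes "cochain2 \<phi>"
  shows "\<phi> y x = - \<phi> x y"
proof -
  have "\<phi> (x + y) (x + y) = \<phi> x x + \<phi> x y + (\<phi> y x + \<phi> y y)"
    using assms[unfolded cochain2_def, THEN conjunct1] by (simp add: bilinear_map_def lin_iff)
  moreover have "\<phi> u u = 0" for u
    using assms by (simp add: cochain2_def)
  ultimately have "0 = \<phi> x y + \<phi> y x"
    by simp
  then show ?thesis
    by (simp add: eq_neg_iff_add_eq_0 add.commute)
qed

text \<open>Swapping the two summations exchanges the roles of u and v, so skewness on basis pairs,
  inherited from \<open>\<mu>\<close> and \<open>\<phi>\<close>, suffices.\<close>

lemma deformed_bracket_skew:
  assumes "cochain2 \<mu>" "cochain2 \<phi>"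
  shows "deformed_bracket \<mu> \<phi> v u = - deformed_bracket \<mu> \<phi> u v"
proof -
  let ?D = "deformed_bracket \<mu> \<phi>"
  have expand: "?D u v = (\<Sum>i\<in>UNIV. \<Sum>j\<in>UNIV. (u $ i * v $ j) *s ?D (axis i 1) (axis j 1))" for u v
    unfolding deformed_bracket_axis by (rule deformed_bracket_def)
  have "?D v u = (\<Sum>j\<in>UNIV. \<Sum>i\<in>UNIV. (v $ i * u $ j) *s ?D (axis i 1) (axis j 1))"
    by (subst expand, subst sum.swap) (rule refl)
  also have "\<dots> = (\<Sum>j\<in>UNIV. \<Sum>i\<in>UNIV. - ((u $ j * v $ i) *s ?D (axis j 1) (axis i 1)))"
  proof (intro sum.cong refl)
    fix i j
    have "?D (axis i 1) (axis j 1) = - ?D (axis j 1) (axis i 1)"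
      unfolding deformed_bracket_axis cochain2_skew[OF assms(1), of "axis i 1"]
        cochain2_skew[OF assms(2), of "axis i 1"]
      by (simp add: const_vec_simps)
    then show "(v $ i * u $ j) *s ?D (axis i 1) (axis j 1) =
        - ((u $ j * v $ i) *s ?D (axis j 1) (axis i 1))"
      by (simp add: vec_eq_iff mult.commute)
  qed
  also have "\<dots> = - ?D u v"
    by (subst expand[of u]) (simp add: sum_negf)
  finally show ?thesis .
qed

text \<open>By \<open>\<bbbK>[[t]]\<close>-trilinearity it suffices to test the Jacobi identity modulo \<open>t\<^sup>2\<close> on
  \<open>\<gg>\<close>, where the coefficients of \<open>1\<close> and \<open>t\<close> are the Jacobi identity of \<open>\<mu>\<close> and the cocycle
  condition.\<close>

lemma infinitesimal_deformation_if_cocycle2: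
  assumes \<mu>: "lie_bracket \<mu>" and \<phi>: "cocycle2 \<mu> \<phi>"
  shows "infinitesimal_deformation \<mu> \<phi>"
proof -
  let ?D = "deformed_bracket \<mu> \<phi>"
  let ?J = "jacobiator ?D"
  have bil: "bilinear_map \<mu>" "bilinear_map \<phi>"
    using assms by (auto simp: lie_bracket_def cocycle2_def cochain2_def)
  note bil_D = deformed_bracket_add deformed_bracket_scale
  have const: "?J (const_vec x) (const_vec y) (const_vec z) =
      fps_X\<^sup>2 *s const_vec (jacobiator \<phi> x y z)" for x y z
  proof -
    have D: "?D (const_vec x) (?D (const_vec y) (const_vec z)) =
        const_vec (\<mu> x (\<mu> y z)) + fps_X *s const_vec (\<mu> x (\<phi> y z) + \<phi> x (\<mu> y z))
          + fps_X\<^sup>2 *s const_vec (\<phi> x (\<phi> y z))" for x y z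
      by (simp add: deformed_bracket_const_vec[OF bil] bil_D const_vec_simps vec_eq_iff
          power2_eq_square algebra_simps)
    have "?J (const_vec x) (const_vec y) (const_vec z) =
        const_vec (jacobiator \<mu> x y z)
        + fps_X *s const_vec ((\<mu> x (\<phi> y z) + \<phi> x (\<mu> y z)) + (\<mu> y (\<phi> z x) + \<phi> y (\<mu> z x))
            + (\<mu> z (\<phi> x y) + \<phi> z (\<mu> x y)))
        + fps_X\<^sup>2 *s const_vec (jacobiator \<phi> x y z)"
      unfolding jacobiator_def D
      by (simp add: const_vec_simps vec_eq_iff algebra_simps)
    moreover have "jacobiator \<mu> x y z = 0"
      using \<mu> by (simp add: lie_bracket_def)
    moreover have "(\<mu> x (\<phi> y z) + \<phi> x (\<mu> y z)) + (\<mu> y (\<phi> z x) + \<phi> y (\<mu> z x))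
            + (\<mu> z (\<phi> x y) + \<phi> z (\<mu> x y)) = 0"
      using \<phi> unfolding cocycle2_def by blast
    ultimately show ?thesis
      by (simp add: const_vec_simps)
  qed
  have J: "?J (u + v) w z = ?J u w z + ?J v w z" "?J (a *s u) w z = a *s ?J u w z"
    "?J w (u + v) z = ?J w u z + ?J w v z" "?J w (a *s u) z = a *s ?J w u z"
    "?J w z (u + v) = ?J w z u + ?J w z v" "?J w z (a *s u) = a *s ?J w z u" for u v w z a
    by (simp_all add: jacobiator_def bil_D vec_eq_iff algebra_simps)
  have "\<exists>r. ?J (axis i 1) (axis j 1) (axis k 1) = fps_X\<^sup>2 *s r" for i j k
    using const[of "axis i 1" "axis j 1" "axis k 1"] by (auto simp: const_vec_simps)
  \<comment> \<open>The arguments are freed from the basis one at a time, the last one first, using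
    linearity in that argument.\<close>
  then have "\<exists>r. ?J (axis i 1) (axis j 1) w = fps_X\<^sup>2 *s r" for i j w
    by (rule linear_image_principal[rotated 2]) (simp_all add: J)
  then have "\<exists>r. ?J (axis i 1) v w = fps_X\<^sup>2 *s r" for i v w
    by (rule linear_image_principal[rotated 2, where f = "\<lambda>v. ?J (axis i 1) v w"])
       (simp_all add: J)
  then have "\<exists>r. ?J u v w = fps_X\<^sup>2 *s r" for u v w
    by (rule linear_image_principal[rotated 2, where f = "\<lambda>u. ?J u v w"])
       (simp_all add: J)
  then show ?thesis
    using assms by (simp add: infinitesimal_deformation_def cocycle2_def)
qed

section \<open>The cocycles \<open>phi7\<close> and the table of brackets\<close>

text \<open>Among basis triples with increasing indices, only (e2, e3, e4) produces nonzero terms: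
  -r e5 and -q e5 from bracketing values of \<open>phi7\<close>, and (q + r) e5 from
  \<open>phi7 (e 3) (- e 5)\<close>. This cancellation explains the value of \<open>phi7\<close> on
  (e3, e5).\<close>

lemma cocycle2_phi7: "cocycle2 h2_bracket (phi7 p q r)"
  unfolding cocycle2_def cochain2_def bilinear_map_def lin_iff
  by (auto simp: h2_bracket_def phi7_def wedge_def vec_eq_iff forall_5 axis_def algebra_simps)

lemma mu_t_d7_skew: "mu_t_d7 p q r v u = - mu_t_d7 p q r u v"
  using lie_bracket_h2 cocycle2_phi7 unfolding mu_t_d7_def lie_bracket_def cocycle2_def
  by (blast intro: deformed_bracket_skew)

lemma mu_t_d7_axis:
  "mu_t_d7 p q r (e i) (e j) =
     const_vec (h2_bracket (e i) (e j)) + fps_X *s const_vec (phi7 p q r (e i) (e j))"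
  by (simp add: mu_t_d7_def deformed_bracket_axis)

lemma mu_t_d7_basis:
  "mu_t_d7 p q r (e 1) (e 3) = e 5 + (fps_X * fps_const p) *s e 1"
  "mu_t_d7 p q r (e 2) (e 3) = fps_X *s e 1 + (fps_const q * fps_X) *s e 2"
  "mu_t_d7 p q r (e 2) (e 4) = e 5"
  "mu_t_d7 p q r (e 3) (e 4) = - (fps_X *s e 2) - (fps_X * fps_const r) *s e 4"
  "mu_t_d7 p q r (e 3) (e 5) = - ((fps_const (r + q) * fps_X) *s e 5)"
  "(i, j) \<in> {(1, 2), (1, 4), (1, 5), (2, 5), (4, 5)} \<Longrightarrow> mu_t_d7 p q r (e i) (e j) = 0"
  by (auto simp: mu_t_d7_axis h2_bracket_basis phi7_basis const_vec_simps
      vec_eq_iff algebra_simps simp flip: fps_const_add)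

section \<open>Coboundaries and the span of the classes in H^2\<close>

text \<open>Modulo the centre \<open>e 5\<close> a coboundary is \<open>f \<circ> h2_bracket\<close>, so off \<open>e 5\<close> it only sees the
  pairs \<open>(1, 3)\<close> and \<open>(2, 4)\<close>, with the same value \<open>f (e 5)\<close>.\<close>

lemma coboundary2_h2_basis:
  fixes \<phi> :: "('k::field)^5 \<Rightarrow> 'k^5 \<Rightarrow> 'k^5"
  assumes "coboundary2 h2_bracket \<phi>" "k \<noteq> 5"
  shows "\<phi> (e 1) (e 3) $ k = \<phi> (e 2) (e 4) $ k" "\<phi> (e 2) (e 3) $ k = 0"
    "\<phi> (e 3) (e 4) $ k = 0"
proof -
  obtain f where f: "Vector_Spaces.linear (*s) (*s) f"
    "\<And>x y. \<phi> x y = f (h2_bracket x y) - h2_bracket (f x) y - h2_bracket x (f y)"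
    using assms(1) by (auto simp: coboundary2_def)
  have [simp]: "f 0 = 0"
    using f(1) by (rule vec.linear_0)
  have "h2_bracket x y $ k = 0" for x y :: "'k^5"
    using assms(2) by (simp add: h2_bracket_def axis_def)
  then have "\<phi> x y $ k = f (h2_bracket x y) $ k" for x y
    by (simp add: f(2))
  then show "\<phi> (e 1) (e 3) $ k = \<phi> (e 2) (e 4) $ k" "\<phi> (e 2) (e 3) $ k = 0"
    "\<phi> (e 3) (e 4) $ k = 0"
    by (simp_all add: h2_bracket_basis)
qed

text \<open>The quotient is by a partial equivalence, reflexive exactly on cocycles; the two
  assumptions supply that reflexivity.\<close>

lemma abs_h2_cohomology_eq_iff:
  assumes "cocycle2 h2_bracket \<phi>" "cocycle2 h2_bracket \<psi>"
  shows "abs_h2_cohomology \<phi> = abs_h2_cohomology \<psi> \<longleftrightarrow>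
    coboundary2 h2_bracket (\<lambda>x y. \<phi> x y - \<psi> x y)"
proof -
  have "abs_h2_cohomology \<phi> = abs_h2_cohomology \<psi> \<longleftrightarrow> cohomologous2 h2_bracket \<phi> \<psi>"
    using Quotient3_rel[OF Quotient3_h2_cohomology, of \<phi> \<psi>] assms
    by (simp add: cohomologous2_h2_refl)
  then show ?thesis
    using assms by (simp add: cohomologous2_def)
qed

abbreviation (input) phi7_class :: "'k::field \<Rightarrow> 'k \<Rightarrow> 'k \<Rightarrow> 'k h2_cohomology" where
  "phi7_class p q r \<equiv> abs_h2_cohomology (phi7 p q r)"

text \<open>Turns a relation between classes into one between explicit cocycles, whose values can be
  computed.\<close>

lemma phi7_class_combine:
  "h2_cohomology_scale a (phi7_class 0 0 0) + (h2_cohomology_scale b (phi7_class 1 0 0) +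
     (h2_cohomology_scale c (phi7_class 0 1 0) + h2_cohomology_scale d (phi7_class 0 0 1))) =
   abs_h2_cohomology (\<lambda>x y. a *s phi7 0 0 0 x y + (b *s phi7 1 0 0 x y +
     (c *s phi7 0 1 0 x y + d *s phi7 0 0 1 x y)))"
  by (simp add: h2_cohomology_scale.abs_eq plus_h2_cohomology.abs_eq cohomologous2_h2_refl
      cocycle2_phi7 cocycle2_h2_closed)

lemma phi7_class_independent:
  assumes "h2_cohomology_scale a (phi7_class 0 0 0) + h2_cohomology_scale b (phi7_class 1 0 0) +
     h2_cohomology_scale c (phi7_class 0 1 0) + h2_cohomology_scale d (phi7_class 0 0 1) = 0"
  shows "a = 0 \<and> b = 0 \<and> c = 0 \<and> d = 0"
proof -
  let ?\<psi> = "\<lambda>x y. a *s phi7 0 0 0 x y + (b *s phi7 1 0 0 x y +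
     (c *s phi7 0 1 0 x y + d *s phi7 0 0 1 x y))"
  have "cocycle2 h2_bracket ?\<psi>"
    by (simp add: cocycle2_phi7 cocycle2_h2_closed)
  moreover have "abs_h2_cohomology ?\<psi> = abs_h2_cohomology (\<lambda>x y. 0)"
    using assms phi7_class_combine[of a b c d]
    by (simp add: add_ac flip: zero_h2_cohomology_def)
  ultimately have "coboundary2 h2_bracket ?\<psi>"
    by (simp add: abs_h2_cohomology_eq_iff cocycle2_zero lie_bracket_h2)
  from coboundary2_h2_basis[OF this]
  \<comment> \<open>By \<open>phi7_basis\<close> these four equations read b = 0, a + b + c + d = 0,
    c = 0 and -d = 0.\<close>
  have "?\<psi> (e 1) (e 3) $ 1 = ?\<psi> (e 2) (e 4) $ 1" "?\<psi> (e 2) (e 3) $ 1 = 0"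
    "?\<psi> (e 2) (e 3) $ 2 = 0" "?\<psi> (e 3) (e 4) $ 4 = 0"
    by simp_all
  then show ?thesis
    by (simp add: phi7_basis) (simp add: axis_def algebra_simps)
qed

lemma dim_span_phi7_class:
  "HH2.dim (HH2.span {phi7_class p q r | p q r :: 'k::field. True}) = 4"
proof -
  let ?S = "{phi7_class p q r | p q r :: 'k. True}"
  let ?B = "{phi7_class 0 0 0, phi7_class 1 0 0, phi7_class 0 1 0, phi7_class 0 0 (1::'k)}"
  note ind = phi7_class_independent[where 'a = 'k]
  \<comment> \<open>Equality of two classes would be a relation with coefficients 1 and -1.
    Distinctness is used both to split sums over \<open>?B\<close> into four terms and to count
    \<open>?B\<close>.\<close>
  have distinct: "phi7_class 0 0 0 \<noteq> phi7_class 1 0 (0::'k)"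
    "phi7_class 0 0 0 \<noteq> phi7_class 0 1 (0::'k)" "phi7_class 0 0 0 \<noteq> phi7_class 0 0 (1::'k)"
    "phi7_class 1 0 0 \<noteq> phi7_class 0 1 (0::'k)" "phi7_class 1 0 0 \<noteq> phi7_class 0 0 (1::'k)"
    "phi7_class 0 1 0 \<noteq> phi7_class 0 0 (1::'k)"
    using ind[of 1 "-1" 0 0] ind[of 1 0 "-1" 0] ind[of 1 0 0 "-1"]
      ind[of 0 1 "-1" 0] ind[of 0 1 0 "-1"] ind[of 0 0 1 "-1"]
    by auto
  have "HH2.independent ?B"
  proof -
    have "u v = 0" if "(\<Sum>v\<in>?B. h2_cohomology_scale (u v) v) = 0" "v \<in> ?B" for u v
    proof -
      have "(\<Sum>v\<in>?B. h2_cohomology_scale (u v) v) =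
          h2_cohomology_scale (u (phi7_class 0 0 0)) (phi7_class 0 0 0) +
          h2_cohomology_scale (u (phi7_class 1 0 0)) (phi7_class 1 0 0) +
          h2_cohomology_scale (u (phi7_class 0 1 0)) (phi7_class 0 1 0) +
          h2_cohomology_scale (u (phi7_class 0 0 1)) (phi7_class 0 0 1)"
        using distinct by (simp add: add_ac)
      then have "u (phi7_class 0 0 0) = 0 \<and> u (phi7_class 1 0 0) = 0 \<and>
          u (phi7_class 0 1 0) = 0 \<and> u (phi7_class 0 0 1) = 0"
        using that(1) by (intro ind) simp
      then show ?thesis
        using that(2) by blast
    qed
    then show ?thesis
      by (subst HH2.dependent_finite) auto
  qed
  moreover have "?S \<subseteq> HH2.span ?B"
  proof -
    have "phi7_class p q r \<in> HH2.span ?B" for p q r :: 'k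
    proof -
      \<comment> \<open>The weights add up to 1 because the parameter-free part
        \<open>phi7 0 0 0\<close> is contained in each of the four generators.\<close>
      have "phi7 p q r = (\<lambda>x y. (1 - p - q - r) *s phi7 0 0 0 x y + (p *s phi7 1 0 0 x y +
          (q *s phi7 0 1 0 x y + r *s phi7 0 0 1 x y)))"
        by (simp add: fun_eq_iff phi7_def vec_eq_iff algebra_simps)
      then show ?thesis
        by (simp only: phi7_class_combine[symmetric])
           (intro HH2.span_add HH2.span_scale; rule HH2.span_base; simp)
    qed
    then show ?thesis by blast
  qed
  moreover have "?B \<subseteq> HH2.span ?S"
    by (auto intro!: HH2.span_base)
  moreover have "card ?B = 4"
    using distinct by simp
  ultimately show ?thesis
    by (intro HH2.dim_unique) (auto simp: HH2.span_minimal)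
qed

theorem theorem4p5:
  shows "(\<forall>p q r :: real.
      cocycle2 h2_bracket (phi7 p q r) \<and>
      infinitesimal_deformation h2_bracket (phi7 p q r) \<and>
      (\<forall>u v. mu_t_d7 p q r v u = - mu_t_d7 p q r u v) \<and>
      mu_t_d7 p q r (e 1) (e 3) = e 5 + (fps_X * fps_const p) *s e 1 \<and>
      mu_t_d7 p q r (e 2) (e 3) = fps_X *s e 1 + (fps_const q * fps_X) *s e 2 \<and>
      mu_t_d7 p q r (e 2) (e 4) = e 5 \<and>
      mu_t_d7 p q r (e 3) (e 4) = - (fps_X *s e 2) - (fps_X * fps_const r) *s e 4 \<and>
      mu_t_d7 p q r (e 3) (e 5) = - ((fps_const (r + q) * fps_X) *s e 5) \<and>
      (\<forall>(i, j) \<in> {(1, 2), (1, 4), (1, 5), (2, 5), (4, 5)}. mu_t_d7 p q r (e i) (e j) = 0)) \<and>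
    HH2.dim (HH2.span {abs_h2_cohomology (phi7 p q r) | p q r :: real. True}) = 4 \<and>
    (\<forall>p q r :: complex.
      cocycle2 h2_bracket (phi7 p q r) \<and>
      infinitesimal_deformation h2_bracket (phi7 p q r) \<and>
      (\<forall>u v. mu_t_d7 p q r v u = - mu_t_d7 p q r u v) \<and>
      mu_t_d7 p q r (e 1) (e 3) = e 5 + (fps_X * fps_const p) *s e 1 \<and>
      mu_t_d7 p q r (e 2) (e 3) = fps_X *s e 1 + (fps_const q * fps_X) *s e 2 \<and>
      mu_t_d7 p q r (e 2) (e 4) = e 5 \<and>
      mu_t_d7 p q r (e 3) (e 4) = - (fps_X *s e 2) - (fps_X * fps_const r) *s e 4 \<and>
      mu_t_d7 p q r (e 3) (e 5) = - ((fps_const (r + q) * fps_X) *s e 5) \<and>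
      (\<forall>(i, j) \<in> {(1, 2), (1, 4), (1, 5), (2, 5), (4, 5)}. mu_t_d7 p q r (e i) (e j) = 0)) \<and>
    HH2.dim (HH2.span {abs_h2_cohomology (phi7 p q r) | p q r :: complex. True}) = 4"
  by (intro conjI allI dim_span_phi7_class mu_t_d7_skew cocycle2_phi7
      infinitesimal_deformation_if_cocycle2 lie_bracket_h2 mu_t_d7_basis)
     (auto simp: mu_t_d7_basis)

end
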